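(* Let $N\ge 2$, $m=\lceil\sqrt{2N}\,\rceil$, and run the averaged subgradient method $x_{k+1}=x_k-h_k(g_k+e_k)$, $k=0,\dots,N-1$, with the stochastic harmonic schedule $$h_k=\frac{R^2}{\varepsilon\,(N+m-k)},\qquad k=0,\dots,N-1,$$ and uniform averaging $x_A=\frac1{N+1}\sum_{k=0}^N x_k$. Then, over all noise laws in the conditionally sub-Gaussian class with parameter $s$, the failure exponent $\mathcal E_N$ of this method satisfies $$\mathcal E_N\;\ge\;\frac{\varepsilon^2}{2R^2s^2}\Big(N+2-m-\frac{2(N+1)}{m}\Big)-\Big(\frac{L^2}{s^2}+\frac d2\Big)\log\frac{N+m}{m-1},$$ and the right-hand side equals $\frac{\varepsilon^2N}{2R^2s^2}\,(1-o(1))$ as $N\to\infty$ with $\varepsilon,R,L,s,d$ fixed.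
   Context: Fix a dimension $d\ge1$, a starting point $x_0\in\mathbb R^d$, constants $R,L,s>0$ and a target accuracy $\varepsilon\in(0,RL)$. $\|\cdot\|$ and $\langle\cdot,\cdot\rangle$ are Euclidean; logarithms are natural. Let $\mathcal C=\mathcal C(R,L)$ be the class of convex (possibly nonsmooth) functions $f:\mathbb R^d\to\mathbb R$ admitting a minimizer $x_\star$ with $\|x_0-x_\star\|\le R$ and such that $\|g\|\le L$ for every $x\in\mathbb R^d$ and every $g\in\partial f(x)$; write $f_\star=f(x_\star)$. Oracle: for an instance $f$, the oracle uses a measurable selection $x\mapsto g(x)\in\partial f(x)$; when the method is at $x_k$ it receives $g_k+e_k$ with $g_k=g(x_k)$ and $e_k$ a random noise vector in $\mathbb R^d$. With $\mathcal F_k=\sigma(\omega,e_0,\dots,e_{k-1})$ ($\omega$ denoting internal randomness of the algorithm, if any, drawn independently of the noise before the run), a noise law $P$ is admissible if for all $k$ $$\mathbb E_P\big[\exp\langle a,e_k\rangle\,\big|\,\mathcal F_k\big]\le\exp\Big(\frac{s^2\|a\|^2}{2}\Big)\qquad\text{for all }a\in\mathbb R^d .$$ The failure exponent of an algorithm with output $x_A$ is $$\mathcal E_N=-\log\,\sup_{f}\ \sup_P\ \mathbb P_P\big(f(x_A)-f_\star\ge\varepsilon\big),$$ the suprema running over all $f\in\mathcal C$ (together with all measurable subgradient selections of the oracle) and all admissible noise laws $P$. *)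

theory Defs
  imports "HOL-Probability.Probability" "HOL-Library.Landau_Symbols"
begin

section \<open>The problem class\<close>

definition subdifferential :: "('a::real_inner \<Rightarrow> real) \<Rightarrow> 'a \<Rightarrow> 'a set" where
  "subdifferential f x = {g. \<forall>y. f y \<ge> f x + g \<bullet> (y - x)}"

definition problem_class :: "real^'n \<Rightarrow> real \<Rightarrow> real \<Rightarrow> (real^'n \<Rightarrow> real) set" where
  "problem_class x0 R L =
     {f. convex_on UNIV f \<and>
         (\<exists>xs. is_arg_min f (\<lambda>_. True) xs \<and> norm (x0 - xs) \<le> R) \<and>
         (\<forall>x. \<forall>g\<in>subdifferential f x. norm g \<le> L)}"

text \<open>Only used for functions that have a minimizer; the value does not depend on which
  minimizer \<open>arg_min\<close> selects.\<close>

definition min_value :: "('a \<Rightarrow> real) \<Rightarrow> real" where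
  "min_value f = f (arg_min f (\<lambda>_. True))"

definition subgradient_selections :: "(real^'n \<Rightarrow> real) \<Rightarrow> (real^'n \<Rightarrow> real^'n) set" where
  "subgradient_selections f =
     {g. g \<in> borel_measurable borel \<and> (\<forall>x. g x \<in> subdifferential f x)}"

section \<open>Noise laws\<close>

text \<open>A noise law is the joint distribution of \<open>(e\<^sub>0, e\<^sub>1, \<dots>)\<close>, a probability measure on the
  path space; \<open>e k\<close> is the \<open>k\<close>-th coordinate of a path. Algorithms are deterministic here (no
  internal randomness), so the history before step \<open>k\<close> is generated by \<open>e\<^sub>0, \<dots>, e\<^sub>k\<^sub>-\<^sub>1\<close> alone.\<close>

abbreviation path_space :: "(nat \<Rightarrow> real^'n) measure" where
  "path_space \<equiv> (\<Pi>\<^sub>M i\<in>UNIV. borel)"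

definition noise_history :: "nat \<Rightarrow> (nat \<Rightarrow> real^'n) measure" where
  "noise_history k = sigma UNIV (\<Union>i<k. {(\<lambda>e. e i) -` A | A. A \<in> sets borel})"

text \<open>The conditional expectation is the extended nonnegative one: \<open>real_cond_exp\<close> turns
  the value \<open>\<infinity>\<close> into 0, which would admit heavy-tailed noise.\<close>

definition admissible_noise :: "real \<Rightarrow> (nat \<Rightarrow> real^'n) measure set" where
  "admissible_noise s =
     {P. prob_space P \<and> sets P = sets path_space \<and>
         (\<forall>k a. AE e in P.
            nn_cond_exp P (noise_history k) (\<lambda>e. ennreal (exp (a \<bullet> e k))) e
              \<le> ennreal (exp (s\<^sup>2 * (norm a)\<^sup>2 / 2)))}"

lemma space_path_space [simp]: "space path_space = UNIV"
  by (simp add: space_PiM)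

lemma subalgebra_noise_history:
  assumes "sets P = sets path_space"
  shows "subalgebra P (noise_history k)"
proof -
  have sp: "space P = UNIV"
    using sets_eq_imp_space_eq[OF assms] by simp
  have "(\<lambda>e. e i) -` A \<in> sets path_space" if "A \<in> sets borel"
    for i :: nat and A :: "(real^'n) set"
    using measurable_sets[OF measurable_component_singleton[of i UNIV "\<lambda>_. borel"] that]
    by simp
  then have "(\<Union>i<k. {(\<lambda>e. e i) -` A | A. A \<in> sets borel}) \<subseteq> sets P"
    using assms by auto
  then have "sigma_sets (space P) (\<Union>i<k. {(\<lambda>e. e i) -` A | A. A \<in> sets borel}) \<subseteq> sets P"
    by (rule sets.sigma_sets_subset)
  then show ?thesis
    by (simp add: subalgebra_def noise_history_def sp)
qed

section \<open>Failure exponent\<close>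

text \<open>The convention \<open>- log 0 = \<infinity>\<close> has to be built in since \<open>ln 0 = 0\<close> on the reals.\<close>

definition neg_log :: "ennreal \<Rightarrow> ereal" where
  "neg_log p = (if p = 0 then \<infinity> else ereal (- ln (enn2real p)))"

text \<open>An algorithm is given by its output \<open>out g e\<close> as a function of the oracle's subgradient
  selection \<open>g\<close> and the noise path \<open>e\<close>.\<close>

definition failure_exponent ::
  "real^'n \<Rightarrow> real \<Rightarrow> real \<Rightarrow> real \<Rightarrow> real \<Rightarrow>
   ((real^'n \<Rightarrow> real^'n) \<Rightarrow> (nat \<Rightarrow> real^'n) \<Rightarrow> real^'n) \<Rightarrow> ereal" where
  "failure_exponent x0 R L s \<epsilon> out =
     neg_log (SUP f \<in> problem_class x0 R L. SUP g \<in> subgradient_selections f.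
              SUP P \<in> admissible_noise s.
                emeasure P {e \<in> space P. f (out g e) - min_value f \<ge> \<epsilon>})"

section \<open>The averaged subgradient method\<close>

fun subgradient_iterate ::
  "'a::real_vector \<Rightarrow> (nat \<Rightarrow> real) \<Rightarrow> ('a \<Rightarrow> 'a) \<Rightarrow> (nat \<Rightarrow> 'a) \<Rightarrow> nat \<Rightarrow> 'a" where
  "subgradient_iterate x0 h g e 0 = x0"
| "subgradient_iterate x0 h g e (Suc k) =
     subgradient_iterate x0 h g e k - h k *\<^sub>R (g (subgradient_iterate x0 h g e k) + e k)"

definition averaged_output ::
  "'a::real_vector \<Rightarrow> (nat \<Rightarrow> real) \<Rightarrow> nat \<Rightarrow> ('a \<Rightarrow> 'a) \<Rightarrow> (nat \<Rightarrow> 'a) \<Rightarrow> 'a" where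
  "averaged_output x0 h N g e =
     (1 / (real N + 1)) *\<^sub>R (\<Sum>k=0..N. subgradient_iterate x0 h g e k)"

definition offset :: "nat \<Rightarrow> nat" where
  "offset N = nat \<lceil>sqrt (2 * real N)\<rceil>"

definition harmonic_step :: "real \<Rightarrow> real \<Rightarrow> nat \<Rightarrow> nat \<Rightarrow> real" where
  "harmonic_step R \<epsilon> N k = R\<^sup>2 / (\<epsilon> * (real N + real (offset N) - real k))"

definition exponent_bound :: "nat \<Rightarrow> real \<Rightarrow> real \<Rightarrow> real \<Rightarrow> real \<Rightarrow> nat \<Rightarrow> real" where
  "exponent_bound d R L s \<epsilon> N =
     (let m = real (offset N) in
        \<epsilon>\<^sup>2 / (2 * R\<^sup>2 * s\<^sup>2) * (real N + 2 - m - 2 * (real N + 1) / m)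
        - (L\<^sup>2 / s\<^sup>2 + real d / 2) * ln ((real N + m) / (m - 1)))"

end

(*
With M = N + m - k the weights 1/h_k = eps M / R^2 drop by eps/R^2 in each step, so the potential
(sum of <g_j, x_j - x*> for j < k) + eps (M + 1) |x_k - x*|^2 / (2 R^2) telescopes, and each step
leaves over a negative term eps |x_k - x*|^2 / (2 R^2). With the exponential rate
eta = (1 - 1/m) eps / (R^2 s^2), this term absorbs the sub-Gaussian cost of the martingale part
<e_k, x_k - x*>. What remains of a step is a factor at most (M / (M - 1))^(L^2/s^2 + d/2), which
comes from |g_k + e_k|^2; these factors telescope to the logarithm. The last summand
<g_N, x_N - x*> is paid for by the quadratic term that is still available at time N, and the bound
follows from the Chernoff inequality.
*)
theory Submission
  imports Defs "HOL-Real_Asymp.Real_Asymp"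
begin

section \<open>Exponential moments of quadratic forms in sub-Gaussian noise\<close>

lemma nn_integral_gaussian_real:
  fixes \<alpha> \<beta> :: real
  assumes "\<alpha> > 0"
  shows "(\<integral>\<^sup>+y. ennreal (exp (\<beta> * y - \<alpha> * y\<^sup>2 / 2)) \<partial>lborel)
           = ennreal (sqrt (2 * pi / \<alpha>) * exp (\<beta>\<^sup>2 / (2 * \<alpha>)))"
proof -
  let ?c = "sqrt (2 * pi / \<alpha>) * exp (\<beta>\<^sup>2 / (2 * \<alpha>))"
  let ?n = "normal_density (\<beta> / \<alpha>) (1 / sqrt \<alpha>)"
  \<comment> \<open>Completing the square: \<open>?n\<close> is centred at the maximiser of the
    exponent and has variance \<open>1 / \<alpha>\<close>.\<close>
  have "exp (\<beta> * y - \<alpha> * y\<^sup>2 / 2) = ?c * ?n y" for y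
  proof -
    have "exp (\<beta>\<^sup>2 / (2 * \<alpha>)) * exp (- (y - \<beta> / \<alpha>)\<^sup>2 * \<alpha> / 2) = exp (\<beta> * y - \<alpha> * y\<^sup>2 / 2)"
      unfolding exp_add[symmetric] using assms by (simp add: field_simps power2_eq_square)
    moreover have "?n y = 1 / sqrt (2 * pi / \<alpha>) * exp (- (y - \<beta> / \<alpha>)\<^sup>2 * \<alpha> / 2)"
      using assms by (simp add: normal_density_def power_divide)
    ultimately show ?thesis
      using assms by simp
  qed
  then have "(\<integral>\<^sup>+y. ennreal (exp (\<beta> * y - \<alpha> * y\<^sup>2 / 2)) \<partial>lborel)
      = (\<integral>\<^sup>+y. ennreal ?c * ennreal (?n y) \<partial>lborel)"
    using assms by (simp add: ennreal_mult)
  also have "\<dots> = ennreal ?c * (\<integral>\<^sup>+y. ennreal (?n y) \<partial>lborel)"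
    by (rule nn_integral_cmult) simp
  also have "(\<integral>\<^sup>+y. ennreal (?n y) \<partial>lborel) = 1"
    using assms by (subst nn_integral_eq_integral) auto
  finally show ?thesis by simp
qed

lemma nn_integral_gaussian:
  fixes \<beta> :: "'a::euclidean_space"
  assumes "\<alpha> > 0"
  shows "(\<integral>\<^sup>+y. ennreal (exp (\<beta> \<bullet> y - \<alpha> * (norm y)\<^sup>2 / 2)) \<partial>lborel)
           = ennreal ((2 * pi / \<alpha>) powr (DIM('a) / 2) * exp ((norm \<beta>)\<^sup>2 / (2 * \<alpha>)))"
proof -
  have norm_sq: "(norm y)\<^sup>2 = (\<Sum>b\<in>Basis. (y \<bullet> b)\<^sup>2)" for y :: 'a
    unfolding power2_norm_eq_inner euclidean_inner[of y y] by (simp add: power2_eq_square)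
  have "exp (\<beta> \<bullet> y - \<alpha> * (norm y)\<^sup>2 / 2)
      = (\<Prod>b\<in>Basis. exp ((\<beta> \<bullet> b) * (y \<bullet> b) - \<alpha> * (y \<bullet> b)\<^sup>2 / 2))" for y
    by (simp add: norm_sq euclidean_inner[of \<beta> y] exp_sum[symmetric] sum_subtractf
        sum_distrib_left sum_divide_distrib)
  then have "(\<integral>\<^sup>+y. ennreal (exp (\<beta> \<bullet> y - \<alpha> * (norm y)\<^sup>2 / 2)) \<partial>lborel)
      = (\<integral>\<^sup>+y. (\<Prod>b\<in>Basis. ennreal (exp ((\<beta> \<bullet> b) * (y \<bullet> b) - \<alpha> * (y \<bullet> b)\<^sup>2 / 2))) \<partial>lborel)"
    by (simp add: prod_ennreal)
  also have "\<dots> = (\<Prod>b\<in>Basis. \<integral>\<^sup>+x. ennreal (exp ((\<beta> \<bullet> b) * x - \<alpha> * x\<^sup>2 / 2)) \<partial>lborel)"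
    by (rule nn_integral_lborel_prod) auto
  also have "\<dots> = (\<Prod>b\<in>(Basis::'a set). ennreal (sqrt (2 * pi / \<alpha>) * exp ((\<beta> \<bullet> b)\<^sup>2 / (2 * \<alpha>))))"
    using assms by (simp add: nn_integral_gaussian_real)
  also have "\<dots> = ennreal (sqrt (2 * pi / \<alpha>) ^ DIM('a) * exp ((norm \<beta>)\<^sup>2 / (2 * \<alpha>)))"
    using assms by (simp add: prod_ennreal prod.distrib norm_sq exp_sum[symmetric] sum_divide_distrib)
  also have "sqrt (2 * pi / \<alpha>) ^ DIM('a) = (2 * pi / \<alpha>) powr (DIM('a) / 2)"
    using assms by (simp add: powr_half_sqrt[symmetric] powr_powr flip: powr_realpow)
  finally show ?thesis .
qed

text \<open>The exponential of a quadratic form is a Gaussian mixture of exponentials \<open>exp (y \<bullet> X)\<close>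
  with \<^emph>\<open>deterministic\<close> direction \<open>y\<close>: the random centre \<open>b\<close> only enters through the mixing
  density, which is \<open>F\<close>-measurable. So the hypothesis for fixed directions suffices.\<close>

lemma subgaussian_quadratic_mgf:
  fixes X b :: "'b \<Rightarrow> 'a::euclidean_space"
  assumes "prob_space M" and subalg: "subalgebra M F"
    and X[measurable]: "X \<in> borel_measurable M"
    and sub: "\<And>a. AE w in M. nn_cond_exp M F (\<lambda>w. ennreal (exp (a \<bullet> X w))) w
                \<le> ennreal (exp (s\<^sup>2 * (norm a)\<^sup>2 / 2))"
    and W: "W \<in> borel_measurable F" and b: "b \<in> borel_measurable F"
    and \<kappa>: "\<kappa> > 0" "\<kappa> * s\<^sup>2 < 1"
  shows "(\<integral>\<^sup>+w. W w * ennreal (exp (b w \<bullet> X w + \<kappa> * (norm (X w))\<^sup>2 / 2)) \<partial>M)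
     \<le> (\<integral>\<^sup>+w. W w * ennreal ((1 - \<kappa> * s\<^sup>2) powr (- (DIM('a) / 2))
                * exp (s\<^sup>2 * (norm (b w))\<^sup>2 / (2 * (1 - \<kappa> * s\<^sup>2)))) \<partial>M)"
proof -
  interpret prob_space M by fact
  interpret finite_measure_subalgebra M F
    by unfold_locales fact
  interpret pair_sigma_finite M "lborel :: 'a measure"
    by (intro pair_sigma_finite.intro sigma_finite_measure_axioms sigma_finite_lborel)
  note WF[measurable] = W b
  have WM[measurable]: "W \<in> borel_measurable M" "b \<in> borel_measurable M"
    using W b subalg by (auto intro: measurable_from_subalg)
  let ?d = "DIM('a) / 2"
  \<comment> \<open>\<open>C\<close> supplies the normalisation: \<open>K w y\<close> is
    \<open>W w\<close> times the density at \<open>y\<close> of the normal law with mean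
    \<open>b w\<close> and covariance \<open>\<kappa>\<close> times the identity. The square is
    expanded so that \<open>nn_integral_gaussian\<close> applies.\<close>
  define C where "C w = ennreal ((2 * pi * \<kappa>) powr (- ?d) * exp (- (norm (b w))\<^sup>2 / (2 * \<kappa>)))" for w
  define K where "K w y = W w * C w * ennreal (exp ((b w /\<^sub>R \<kappa>) \<bullet> y - 1 / \<kappa> * (norm y)\<^sup>2 / 2))"
    for w y
  have [measurable]: "case_prod K \<in> borel_measurable (M \<Otimes>\<^sub>M lborel)"
    unfolding K_def C_def by measurable
  have KF[measurable]: "(\<lambda>w. K w y) \<in> borel_measurable F" for y
    unfolding K_def C_def by measurable
  \<comment> \<open>One formula serves both ends of the argument: \<open>t = 0\<close> with
    \<open>v = X w\<close> returns the left side of the claim, \<open>t = s\<^sup>2\<close> with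
    \<open>v = 0\<close> the right side. The condition \<open>\<kappa> * t < 1\<close> keeps the
    coefficient of the Gaussian in \<open>y\<close> positive.\<close>
  have mix: "(\<integral>\<^sup>+y. K w y * ennreal (exp (y \<bullet> v + t * (norm y)\<^sup>2 / 2)) \<partial>lborel)
      = W w * ennreal ((1 - \<kappa> * t) powr (- ?d)
          * exp ((2 * (b w \<bullet> v) + \<kappa> * (norm v)\<^sup>2 + t * (norm (b w))\<^sup>2) / (2 * (1 - \<kappa> * t))))"
    if t: "\<kappa> * t < 1" for w v t
  proof -
    let ?\<alpha> = "1 / \<kappa> - t" and ?\<beta> = "b w /\<^sub>R \<kappa> + v"
    have \<alpha>: "?\<alpha> > 0"
      using t \<kappa> by (simp add: field_simps)
    have "(\<integral>\<^sup>+y. K w y * ennreal (exp (y \<bullet> v + t * (norm y)\<^sup>2 / 2)) \<partial>lborel)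
        = (\<integral>\<^sup>+y. W w * C w * ennreal (exp (?\<beta> \<bullet> y - ?\<alpha> * (norm y)\<^sup>2 / 2)) \<partial>lborel)"
      unfolding K_def mult.assoc
      by (simp add: ennreal_mult[symmetric] exp_add[symmetric] inner_add_left inner_commute
          algebra_simps add_divide_distrib diff_divide_distrib)
    also have "\<dots> = W w * (C w * ennreal ((2 * pi / ?\<alpha>) powr ?d * exp ((norm ?\<beta>)\<^sup>2 / (2 * ?\<alpha>))))"
      using \<alpha> by (subst nn_integral_cmult) (auto simp: nn_integral_gaussian mult.assoc)
    also have "C w * ennreal ((2 * pi / ?\<alpha>) powr ?d * exp ((norm ?\<beta>)\<^sup>2 / (2 * ?\<alpha>)))
        = ennreal (((2 * pi * \<kappa>) powr (- ?d) * (2 * pi / ?\<alpha>) powr ?d)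
            * exp (- (norm (b w))\<^sup>2 / (2 * \<kappa>) + (norm ?\<beta>)\<^sup>2 / (2 * ?\<alpha>)))"
      unfolding C_def exp_add by (simp add: ennreal_mult[symmetric] mult.assoc mult.left_commute del: times_divide_eq_left times_divide_eq_right mult_minus_left)
    also have "(2 * pi * \<kappa>) powr (- ?d) * (2 * pi / ?\<alpha>) powr ?d = (1 - \<kappa> * t) powr (- ?d)"
    proof -
      have "2 * pi / ?\<alpha> = (2 * pi * \<kappa>) / (1 - \<kappa> * t)"
        using \<kappa> t by (simp add: field_simps)
      then show ?thesis
        using \<kappa> t by (simp add: powr_divide powr_minus field_simps)
    qed
    also have "- (norm (b w))\<^sup>2 / (2 * \<kappa>) + (norm ?\<beta>)\<^sup>2 / (2 * ?\<alpha>)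
        = (2 * (b w \<bullet> v) + \<kappa> * (norm v)\<^sup>2 + t * (norm (b w))\<^sup>2) / (2 * (1 - \<kappa> * t))"
    proof -
      have "(norm ?\<beta>)\<^sup>2 = (norm (b w))\<^sup>2 / \<kappa>\<^sup>2 + 2 * (b w \<bullet> v) / \<kappa> + (norm v)\<^sup>2"
        using \<kappa> unfolding power2_norm_eq_inner
        by (simp add: inner_add_left inner_add_right inner_commute power2_eq_square field_simps)
      moreover have "- B / (2 * \<kappa>) + (B / \<kappa>\<^sup>2 + 2 * p / \<kappa> + V) / (2 * ?\<alpha>)
          = (2 * p + \<kappa> * V + t * B) / (2 * (1 - \<kappa> * t))" for B p V :: real
      proof -
        have "2 * ?\<alpha> = 2 * (1 - \<kappa> * t) / \<kappa>"
          using \<kappa> by (simp add: field_simps)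
        moreover have "1 - \<kappa> * t \<noteq> 0"
          using t by simp
        ultimately show ?thesis
          using \<kappa> by (simp add: divide_simps power2_eq_square) (simp add: algebra_simps)
      qed
      ultimately show ?thesis
        by simp
    qed
    finally show ?thesis .
  qed
  \<comment> \<open>For fixed \<open>y\<close> the factor \<open>K w y\<close> is
    \<open>F\<close>-measurable in \<open>w\<close>, so the conditional bound can be inserted. Its
    exceptional null set may depend on \<open>y\<close>; this is harmless because the integral over
    \<open>w\<close> is taken inside the one over \<open>y\<close>.\<close>
  have step: "(\<integral>\<^sup>+w. K w y * ennreal (exp (y \<bullet> X w)) \<partial>M)
      \<le> (\<integral>\<^sup>+w. K w y * ennreal (exp (s\<^sup>2 * (norm y)\<^sup>2 / 2)) \<partial>M)" for y
  proof -
    have "(\<integral>\<^sup>+w. K w y * ennreal (exp (y \<bullet> X w)) \<partial>M)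
        = (\<integral>\<^sup>+w. K w y * nn_cond_exp M F (\<lambda>w. ennreal (exp (y \<bullet> X w))) w \<partial>M)"
      by (rule nn_cond_exp_intg[symmetric]) auto
    also have "\<dots> \<le> (\<integral>\<^sup>+w. K w y * ennreal (exp (s\<^sup>2 * (norm y)\<^sup>2 / 2)) \<partial>M)"
      using sub[of y] by (intro nn_integral_mono_AE) (auto elim!: eventually_mono intro: mult_left_mono)
    finally show ?thesis .
  qed
  have "(\<integral>\<^sup>+w. W w * ennreal (exp (b w \<bullet> X w + \<kappa> * (norm (X w))\<^sup>2 / 2)) \<partial>M)
      = (\<integral>\<^sup>+w. \<integral>\<^sup>+y. K w y * ennreal (exp (y \<bullet> X w)) \<partial>lborel \<partial>M)"
    using mix[of 0] by (simp add: add_divide_distrib)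
  also have "\<dots> = (\<integral>\<^sup>+y. \<integral>\<^sup>+w. K w y * ennreal (exp (y \<bullet> X w)) \<partial>M \<partial>lborel)"
    by (rule Fubini'[symmetric]) measurable
  also have "\<dots> \<le> (\<integral>\<^sup>+y. \<integral>\<^sup>+w. K w y * ennreal (exp (s\<^sup>2 * (norm y)\<^sup>2 / 2)) \<partial>M \<partial>lborel)"
    by (intro nn_integral_mono step)
  also have "\<dots> = (\<integral>\<^sup>+w. \<integral>\<^sup>+y. K w y * ennreal (exp (s\<^sup>2 * (norm y)\<^sup>2 / 2)) \<partial>lborel \<partial>M)"
    by (rule Fubini') measurable
  also have "\<dots> = (\<integral>\<^sup>+w. W w * ennreal ((1 - \<kappa> * s\<^sup>2) powr (- ?d)
      * exp (s\<^sup>2 * (norm (b w))\<^sup>2 / (2 * (1 - \<kappa> * s\<^sup>2)))) \<partial>M)"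
    using mix[of "s\<^sup>2" _ 0] \<kappa> by simp
  finally show ?thesis .
qed

section \<open>The potential along the iteration\<close>

lemma measurable_noise_history_component:
  assumes "i < k"
  shows "(\<lambda>e. e i) \<in> borel_measurable (noise_history k)"
proof (rule measurableI)
  show "(\<lambda>e. e i) -` A \<inter> space (noise_history k) \<in> sets (noise_history k)"
    if "A \<in> sets borel" for A
    using assms that by (auto simp: noise_history_def intro!: sigma_sets.Basic)
qed simp

text \<open>An iterate is built only from noise vectors of smaller index. The case
  \<open>i = k\<close> makes the direction that is paired with \<open>e k\<close> measurable with
  respect to the past.\<close>

lemma measurable_subgradient_iterate:
  fixes x0 :: "real^'n"
  assumes g: "g \<in> borel_measurable borel" and "i \<le> k"
  shows "(\<lambda>e. subgradient_iterate x0 h g e i) \<in> borel_measurable (noise_history k)"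
  using \<open>i \<le> k\<close>
proof (induction i)
  case (Suc i)
  note [measurable] = g measurable_noise_history_component[of i k]
  have [measurable]: "(\<lambda>e. subgradient_iterate x0 h g e i) \<in> borel_measurable (noise_history k)"
    using Suc by simp
  show ?case
    using Suc.prems by simp
qed simp

text \<open>This is the linearised regret: for a subgradient selection, convexity makes each summand
  dominate the gap of \<open>f\<close> between that iterate and \<open>xs\<close>. The range leaves
  out iterate \<open>k\<close>, so the average of \<open>N + 1\<close> iterates corresponds to index
  \<open>Suc N\<close>.\<close>

definition regret :: "'a::real_inner \<Rightarrow> (nat \<Rightarrow> real) \<Rightarrow> ('a \<Rightarrow> 'a) \<Rightarrow> 'a \<Rightarrow> nat \<Rightarrow> (nat \<Rightarrow> 'a) \<Rightarrow> real"
  where "regret x0 h g xs k e =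
    (\<Sum>j<k. g (subgradient_iterate x0 h g e j) \<bullet> (subgradient_iterate x0 h g e j - xs))"

text \<open>The weight \<open>v\<close> is a free parameter because the same iterate is assessed
  with two weights: the one left by the step before it and the smaller \<open>1 / h k\<close> from
  which the next step starts.\<close>

definition potential ::
  "'a::real_inner \<Rightarrow> (nat \<Rightarrow> real) \<Rightarrow> ('a \<Rightarrow> 'a) \<Rightarrow> 'a \<Rightarrow> real \<Rightarrow> nat \<Rightarrow> (nat \<Rightarrow> 'a) \<Rightarrow> real"
  where "potential x0 h g xs v k e =
    regret x0 h g xs k e + v * (norm (subgradient_iterate x0 h g e k - xs))\<^sup>2 / 2"

lemma measurable_regret:
  fixes x0 :: "real^'n"
  assumes [measurable]: "g \<in> borel_measurable borel"
  shows "regret x0 h g xs k \<in> borel_measurable (noise_history k)"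
proof -
  have [measurable]: "(\<lambda>e. subgradient_iterate x0 h g e j) \<in> borel_measurable (noise_history k)"
    if "j \<in> {..<k}" for j
    using that by (intro measurable_subgradient_iterate) auto
  show ?thesis
    unfolding regret_def by measurable
qed

lemma measurable_potential:
  fixes x0 :: "real^'n"
  assumes [measurable]: "g \<in> borel_measurable borel"
  shows "potential x0 h g xs v k \<in> borel_measurable (noise_history k)"
proof -
  note [measurable] = measurable_subgradient_iterate[OF assms order_refl, of x0 h k]
    measurable_regret[OF assms, of x0 h xs k]
  show ?thesis
    unfolding potential_def by measurable
qed

text \<open>Expanding the squared distance after the step gives a cross term between
  \<open>g\<close> and \<open>x - xs\<close>. With weight \<open>1 / h k\<close> it cancels exactly
  the summand that the regret gains. The noise is left in linear and quadratic form, as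
  \<open>subgaussian_quadratic_mgf\<close> requires.\<close>

lemma potential_Suc:
  fixes x0 :: "'a::real_inner" and g :: "'a \<Rightarrow> 'a" and h :: "nat \<Rightarrow> real" and k :: nat
  assumes "h k > 0"
  defines "x \<equiv> \<lambda>e. subgradient_iterate x0 h g e k"
  shows "potential x0 h g xs (1 / h k) (Suc k) e
     = potential x0 h g xs (1 / h k) k e + h k * (norm (g (x e)))\<^sup>2 / 2
        - (x e - xs - h k *\<^sub>R g (x e)) \<bullet> e k + h k * (norm (e k))\<^sup>2 / 2"
proof -
  have "(norm (z - h k *\<^sub>R (u + w)))\<^sup>2
      = (norm z)\<^sup>2 - 2 * h k * (u \<bullet> z) + (h k)\<^sup>2 * (norm u)\<^sup>2 - 2 * h k * ((z - h k *\<^sub>R u) \<bullet> w)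
        + (h k)\<^sup>2 * (norm w)\<^sup>2" for z u w :: 'a
    unfolding power2_norm_eq_inner
    by (simp add: inner_diff_left inner_diff_right inner_add_left inner_add_right inner_commute
        power2_eq_square algebra_simps)
  from this[of "x e - xs" "g (x e)" "e k"]
  have sq: "(norm (subgradient_iterate x0 h g e (Suc k) - xs))\<^sup>2
      = (norm (x e - xs))\<^sup>2 - 2 * h k * (g (x e) \<bullet> (x e - xs)) + (h k)\<^sup>2 * (norm (g (x e)))\<^sup>2
        - 2 * h k * ((x e - xs - h k *\<^sub>R g (x e)) \<bullet> e k) + (h k)\<^sup>2 * (norm (e k))\<^sup>2"
    by (simp add: x_def algebra_simps)
  show ?thesis
    unfolding potential_def sq using assms(1)
    by (simp add: regret_def x_def field_simps power2_eq_square)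
qed

text \<open>The noise cost of a step has two parts. One is proportional to the squared distance to
  \<open>xs\<close> and is absorbed by raising the weight from \<open>1 / h k\<close> to
  \<open>v\<close>; the other involves only the subgradient norm and goes into the deterministic
  factor.\<close>

lemma potential_mgf_step:
  fixes x0 :: "real^'n"
  assumes P: "P \<in> admissible_noise s"
    and g: "g \<in> borel_measurable borel" "\<And>x. norm (g x) \<le> L" "\<And>x. 0 \<le> g x \<bullet> (x - xs)"
    and pos: "h k > 0" "\<eta> > 0"
    and small: "\<eta> * h k * s\<^sup>2 < 1"
    and v: "1 / h k + \<eta> * s\<^sup>2 / (1 - \<eta> * h k * s\<^sup>2) \<le> v"
  shows "(\<integral>\<^sup>+e. ennreal (exp (\<eta> * potential x0 h g xs (1 / h k) (Suc k) e)) \<partial>P)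
     \<le> ennreal ((1 - \<eta> * h k * s\<^sup>2) powr (- (real CARD('n) / 2))
            * exp (\<eta> * h k * L\<^sup>2 / (2 * (1 - \<eta> * h k * s\<^sup>2))))
        * (\<integral>\<^sup>+e. ennreal (exp (\<eta> * potential x0 h g xs v k e)) \<partial>P)"
proof -
  let ?c = "1 - \<eta> * h k * s\<^sup>2" and ?d = "real CARD('n) / 2"
  have P': "prob_space P" "sets P = sets path_space"
    and sub: "\<And>a. AE e in P. nn_cond_exp P (noise_history k) (\<lambda>e. ennreal (exp (a \<bullet> e k))) e
              \<le> ennreal (exp (s\<^sup>2 * (norm a)\<^sup>2 / 2))"
    using P by (auto simp: admissible_noise_def)
  have subalg: "subalgebra P (noise_history k)"
    using P'(2) by (rule subalgebra_noise_history)
  have comp: "(\<lambda>e. e k) \<in> borel_measurable P"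
    unfolding measurable_cong_sets[OF P'(2) refl] by measurable
  define x where "x e = subgradient_iterate x0 h g e k" for e
  note [measurable] = g(1) measurable_subgradient_iterate[OF g(1) order_refl, of x0 h k, folded x_def]
    measurable_potential[OF g(1), of x0 h xs _ k]
  \<comment> \<open>\<open>b\<close> is the direction paired with the new noise, \<open>W\<close>
    the part of the exponent already known before step \<open>k\<close>. The parameter
    \<open>\<kappa>\<close> of \<open>subgaussian_quadratic_mgf\<close> becomes
    \<open>\<eta> * h k\<close>.\<close>
  define b where "b e = - \<eta> *\<^sub>R (x e - xs - h k *\<^sub>R g (x e))" for e
  define W where "W e = \<eta> * (potential x0 h g xs (1 / h k) k e + h k * (norm (g (x e)))\<^sup>2 / 2)" for e
  have [measurable]: "b \<in> borel_measurable (noise_history k)" "W \<in> borel_measurable (noise_history k)"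
    unfolding b_def W_def by measurable
  have "(\<integral>\<^sup>+e. ennreal (exp (\<eta> * potential x0 h g xs (1 / h k) (Suc k) e)) \<partial>P)
      = (\<integral>\<^sup>+e. ennreal (exp (W e)) * ennreal (exp (b e \<bullet> e k + \<eta> * h k * (norm (e k))\<^sup>2 / 2)) \<partial>P)"
    by (simp add: ennreal_mult[symmetric] exp_add[symmetric] potential_Suc[where h = h and k = k, OF pos(1)] W_def b_def x_def
        algebra_simps)
  also have "\<dots> \<le> (\<integral>\<^sup>+e. ennreal (exp (W e)) * ennreal (?c powr (- (DIM(real^'n) / 2))
      * exp (s\<^sup>2 * (norm (b e))\<^sup>2 / (2 * ?c))) \<partial>P)"
    using pos small by (intro subgaussian_quadratic_mgf[OF P'(1) subalg comp sub]) auto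
  also have "\<dots> \<le> (\<integral>\<^sup>+e. ennreal (?c powr (- ?d) * exp (\<eta> * h k * L\<^sup>2 / (2 * ?c)))
      * ennreal (exp (\<eta> * potential x0 h g xs v k e)) \<partial>P)"
  proof (rule nn_integral_mono)
    fix e
    let ?z = "norm (x e - xs)" and ?g = "norm (g (x e))"
    have c: "?c > 0"
      using small by simp
    have gL: "?g\<^sup>2 \<le> L\<^sup>2"
      using g(2) by (intro power_mono) auto
    have "(norm (x e - xs - h k *\<^sub>R g (x e)))\<^sup>2
        = ?z\<^sup>2 - 2 * h k * (g (x e) \<bullet> (x e - xs)) + (h k)\<^sup>2 * ?g\<^sup>2"
      unfolding power2_norm_eq_inner
      by (simp add: inner_diff_left inner_diff_right inner_commute power2_eq_square algebra_simps)
    \<comment> \<open>The cross term is dropped by \<open>g(3)\<close>: subgradients have a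
      nonnegative component along \<open>x - xs\<close>.\<close>
    also have "\<dots> \<le> ?z\<^sup>2 + (h k)\<^sup>2 * ?g\<^sup>2"
      using g(3)[of "x e"] pos by simp
    finally have "s\<^sup>2 * (norm (b e))\<^sup>2 / (2 * ?c) \<le> s\<^sup>2 * (\<eta>\<^sup>2 * (?z\<^sup>2 + (h k)\<^sup>2 * ?g\<^sup>2)) / (2 * ?c)"
      using c by (intro divide_right_mono mult_left_mono)
        (auto simp: b_def power_mult_distrib intro!: mult_left_mono)
    also have "\<dots> = \<eta> * (\<eta> * s\<^sup>2 / ?c) * ?z\<^sup>2 / 2 + \<eta> * h k * ?g\<^sup>2 / 2 * (\<eta> * h k * s\<^sup>2 / ?c)"
    proof -
      have "s\<^sup>2 * (\<eta>\<^sup>2 * (Z + (h k)\<^sup>2 * G)) / (2 * C)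
          = \<eta> * (\<eta> * s\<^sup>2 / C) * Z / 2 + \<eta> * h k * G / 2 * (\<eta> * h k * s\<^sup>2 / C)" for Z G C :: real
        by (simp add: algebra_simps add_divide_distrib power2_eq_square)
      then show ?thesis .
    qed
    finally have "W e + s\<^sup>2 * (norm (b e))\<^sup>2 / (2 * ?c)
        \<le> \<eta> * potential x0 h g xs (1 / h k + \<eta> * s\<^sup>2 / ?c) k e
          + \<eta> * h k * ?g\<^sup>2 / 2 * (1 + \<eta> * h k * s\<^sup>2 / ?c)"
      by (simp add: W_def potential_def x_def algebra_simps add_divide_distrib)
    \<comment> \<open>The subgradient term from \<open>W\<close> and its share of the noise cost
      merge by \<open>1 + u / (1 - u) = 1 / (1 - u)\<close>.\<close>
    also have "\<eta> * h k * ?g\<^sup>2 / 2 * (1 + \<eta> * h k * s\<^sup>2 / ?c) = \<eta> * h k * ?g\<^sup>2 / (2 * ?c)"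
    proof -
      have "1 + \<eta> * h k * s\<^sup>2 / ?c = 1 / ?c"
        using c by (simp add: field_simps)
      then show ?thesis by simp
    qed
    also have "\<dots> \<le> \<eta> * h k * L\<^sup>2 / (2 * ?c)"
      using c gL pos by (intro divide_right_mono mult_left_mono) auto
    also have "\<eta> * potential x0 h g xs (1 / h k + \<eta> * s\<^sup>2 / ?c) k e \<le> \<eta> * potential x0 h g xs v k e"
      using v pos unfolding potential_def
      by (intro mult_left_mono add_left_mono divide_right_mono mult_right_mono) auto
    finally have "exp (W e) * exp (s\<^sup>2 * (norm (b e))\<^sup>2 / (2 * ?c))
        \<le> exp (\<eta> * h k * L\<^sup>2 / (2 * ?c)) * exp (\<eta> * potential x0 h g xs v k e)"
      by (simp add: exp_add[symmetric] add.commute)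
    from mult_left_mono[OF this, of "?c powr (- ?d)"]
    show "ennreal (exp (W e)) * ennreal (?c powr (- (DIM(real^'n) / 2))
        * exp (s\<^sup>2 * (norm (b e))\<^sup>2 / (2 * ?c)))
      \<le> ennreal (?c powr (- ?d) * exp (\<eta> * h k * L\<^sup>2 / (2 * ?c)))
        * ennreal (exp (\<eta> * potential x0 h g xs v k e))"
      by (simp add: ennreal_mult[symmetric] mult.assoc mult.left_commute)
  qed
  also have "\<dots> = ennreal (?c powr (- ?d) * exp (\<eta> * h k * L\<^sup>2 / (2 * ?c)))
      * (\<integral>\<^sup>+e. ennreal (exp (\<eta> * potential x0 h g xs v k e)) \<partial>P)"
    by (intro nn_integral_cmult measurable_from_subalg[OF subalg]) measurable
  finally show ?thesis .
qed

section \<open>The harmonic schedule\<close>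

text \<open>The inequality \<open>ln t \<le> t - 1\<close> at \<open>t = (M - 1) / M\<close> gives
  the lower bound \<open>1 / M\<close>, which is at least the stated one. The stated form is the
  shape that the subgradient exponent takes at \<open>\<theta> = 1\<close>.\<close>

lemma inverse_le_ln_ratio:
  fixes M :: real
  assumes "M \<ge> 2"
  shows "1 / (2 * (M - 1)) \<le> ln (M / (M - 1))"
proof -
  have "ln ((M - 1) / M) \<le> (M - 1) / M - 1"
    using assms by (intro ln_le_minus_one) auto
  moreover have "ln ((M - 1) / M) = - ln (M / (M - 1))"
    using assms by (simp add: ln_div)
  moreover have "(M - 1) / M - 1 = - (1 / M)"
    using assms by (simp add: field_simps)
  moreover have "1 / (2 * (M - 1)) \<le> 1 / M"
    using assms by (intro divide_left_mono) auto
  ultimately show ?thesis by linarith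
qed

text \<open>Both factors increase with \<open>\<theta>\<close>, so \<open>\<theta> = 1\<close> is
  the worst case. There the first is exactly the power \<open>d / 2\<close>, and
  \<open>inverse_le_ln_ratio\<close> bounds the second by the power \<open>a\<close>, which stands
  for \<open>L\<^sup>2 / s\<^sup>2\<close>.\<close>

lemma step_factor_bound:
  fixes \<theta> M a d :: real
  assumes "0 \<le> \<theta>" "\<theta> \<le> 1" "M \<ge> 2" "a \<ge> 0" "d \<ge> 0"
  shows "(1 - \<theta> / M) powr (- (d / 2)) * exp (a * \<theta> / (2 * (M - \<theta>)))
    \<le> (M / (M - 1)) powr (a + d / 2)"
proof -
  have "(1 - \<theta> / M) powr (- (d / 2)) \<le> (1 - 1 / M) powr (- (d / 2))"
    using assms by (intro powr_mono2') (auto simp: divide_right_mono field_simps)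
  also have "1 - 1 / M = (M - 1) / M"
    using assms by (simp add: field_simps)
  also have "\<dots> powr (- (d / 2)) = (M / (M - 1)) powr (d / 2)"
    using assms by (simp add: powr_divide powr_minus)
  finally have 1: "(1 - \<theta> / M) powr (- (d / 2)) \<le> (M / (M - 1)) powr (d / 2)" .
  have "\<theta> / (2 * (M - \<theta>)) \<le> 1 / (2 * (M - 1))"
    using assms by (intro frac_le) auto
  also have "\<dots> \<le> ln (M / (M - 1))"
    using assms by (intro inverse_le_ln_ratio)
  finally have "exp (a * \<theta> / (2 * (M - \<theta>))) \<le> exp (a * ln (M / (M - 1)))"
    using assms(4) by (simp add: mult_left_mono flip: times_divide_eq_right)
  also have "\<dots> = (M / (M - 1)) powr a"
    using assms by (simp add: powr_def)
  finally have "(1 - \<theta> / M) powr (- (d / 2)) * exp (a * \<theta> / (2 * (M - \<theta>)))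
      \<le> (M / (M - 1)) powr (d / 2) * (M / (M - 1)) powr a"
    by (intro mult_mono 1) auto
  then show ?thesis
    by (simp add: powr_add mult.commute)
qed

text \<open>The weight at time \<open>k\<close> exceeds \<open>1 / h k\<close> by exactly
  \<open>\<epsilon> / R\<^sup>2\<close>, the surplus that pays for the noise of step
  \<open>k\<close>; for positive \<open>k\<close> it equals the reciprocal of the preceding step
  size. At \<open>k = 0\<close> the bound on the initial distance yields the constant
  \<open>\<epsilon> * (real N + m + 1) / 2\<close>.\<close>

lemma potential_mgf_bound:
  fixes x0 :: "real^'n"
  assumes P: "P \<in> admissible_noise s"
    and g: "g \<in> borel_measurable borel" "\<And>x. norm (g x) \<le> L" "\<And>x. 0 \<le> g x \<bullet> (x - xs)"
    and pos: "R > 0" "s > 0" "\<epsilon> > 0"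
    and dist: "norm (x0 - xs) \<le> R"
    and m: "real (offset N) \<ge> 2" and k: "k \<le> N"
  defines "m \<equiv> real (offset N)"
  defines "\<eta> \<equiv> (1 - 1 / m) * \<epsilon> / (R\<^sup>2 * s\<^sup>2)"
    and "M \<equiv> (\<lambda>k. real N + m - real k)"
  shows "(\<integral>\<^sup>+e. ennreal (exp (\<eta> * potential x0 (harmonic_step R \<epsilon> N) g xs (\<epsilon> * (M k + 1) / R\<^sup>2) k e)) \<partial>P)
     \<le> ennreal (exp (\<eta> * (\<epsilon> * (real N + m + 1) / 2))
          * ((real N + m) / M k) powr (L\<^sup>2 / s\<^sup>2 + real CARD('n) / 2))"
  using k
proof (induction k)
  case 0
  interpret prob_space P
    using P by (simp add: admissible_noise_def)
  have \<eta>: "\<eta> \<ge> 0"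
    using m pos by (auto simp: \<eta>_def m_def)
  have "(norm (x0 - xs))\<^sup>2 \<le> R\<^sup>2"
    using dist by (intro power_mono) auto
  then have "\<epsilon> * (M 0 + 1) / R\<^sup>2 * (norm (x0 - xs))\<^sup>2 / 2 \<le> \<epsilon> * (M 0 + 1) / R\<^sup>2 * R\<^sup>2 / 2"
    using pos m by (intro divide_right_mono mult_left_mono) (auto simp: M_def m_def)
  also have "\<dots> = \<epsilon> * (real N + m + 1) / 2"
    using pos by (simp add: M_def)
  finally have "exp (\<eta> * potential x0 (harmonic_step R \<epsilon> N) g xs (\<epsilon> * (M 0 + 1) / R\<^sup>2) 0 e)
      \<le> exp (\<eta> * (\<epsilon> * (real N + m + 1) / 2))" for e
    using \<eta> by (simp add: potential_def regret_def mult_left_mono del: times_divide_eq_right times_divide_eq_left)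
  then have "(\<integral>\<^sup>+e. ennreal (exp (\<eta> * potential x0 (harmonic_step R \<epsilon> N) g xs (\<epsilon> * (M 0 + 1) / R\<^sup>2) 0 e)) \<partial>P)
      \<le> (\<integral>\<^sup>+e. ennreal (exp (\<eta> * (\<epsilon> * (real N + m + 1) / 2))) \<partial>P)"
    by (intro nn_integral_mono ennreal_leI)
  then show ?case
    using m by (simp add: emeasure_space_1 M_def m_def)
next
  case (Suc k)
  let ?h = "harmonic_step R \<epsilon> N" and ?q = "L\<^sup>2 / s\<^sup>2 + real CARD('n) / 2"
  define \<theta> where "\<theta> = 1 - 1 / m"
  have m2: "m \<ge> 2"
    using m by (simp add: m_def)
  have \<theta>: "0 < \<theta>" "\<theta> \<le> 1"
    using m2 by (auto simp: \<theta>_def)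
  have M: "M k \<ge> m + 1" "M (Suc k) = M k - 1"
    using Suc.prems by (auto simp: M_def)
  then have M2: "M k > 2"
    using m2 by simp
  have h: "?h k = R\<^sup>2 / (\<epsilon> * M k)"
    by (simp add: harmonic_step_def M_def m_def)
  have \<eta>: "\<eta> = \<theta> * \<epsilon> / (R\<^sup>2 * s\<^sup>2)"
    by (simp add: \<eta>_def \<theta>_def)
  have c: "\<eta> * ?h k * s\<^sup>2 = \<theta> / M k"
    using pos M2 by (simp add: \<eta> h field_simps)
  have c1: "1 - \<theta> / M k > 0"
    using \<theta> M2 by (simp add: field_simps)
  have ih: "(\<integral>\<^sup>+e. ennreal (exp (\<eta> * potential x0 ?h g xs (\<epsilon> * (M k + 1) / R\<^sup>2) k e)) \<partial>P)
     \<le> ennreal (exp (\<eta> * (\<epsilon> * (real N + m + 1) / 2)) * ((real N + m) / M k) powr ?q)"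
    using Suc by simp
  have v': "\<epsilon> * (M (Suc k) + 1) / R\<^sup>2 = 1 / ?h k"
    by (simp add: h M)
  have "(\<integral>\<^sup>+e. ennreal (exp (\<eta> * potential x0 ?h g xs (1 / ?h k) (Suc k) e)) \<partial>P)
      \<le> ennreal ((1 - \<eta> * ?h k * s\<^sup>2) powr (- (real CARD('n) / 2))
            * exp (\<eta> * ?h k * L\<^sup>2 / (2 * (1 - \<eta> * ?h k * s\<^sup>2))))
        * (\<integral>\<^sup>+e. ennreal (exp (\<eta> * potential x0 ?h g xs (\<epsilon> * (M k + 1) / R\<^sup>2) k e)) \<partial>P)"
  proof (rule potential_mgf_step[OF P g])
    show "?h k > 0" "\<eta> > 0" "\<eta> * ?h k * s\<^sup>2 < 1"
      using pos M2 \<theta> c1 unfolding c by (auto simp: h \<eta>)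
    \<comment> \<open>This is the reason for \<open>\<theta> = 1 - 1 / m\<close>: from
      \<open>M k \<ge> m\<close> the product is at most \<open>1 - 1 / m\<^sup>2\<close>, so the
      noise cost stays within the surplus \<open>\<epsilon> / R\<^sup>2\<close>.\<close>
    have "\<theta> * (1 + 1 / M k) \<le> \<theta> * (1 + 1 / m)"
      using \<theta> M m2 by (intro mult_left_mono add_left_mono divide_left_mono) auto
    also have "\<dots> \<le> 1"
      using m2 by (simp add: \<theta>_def field_simps)
    finally have "\<theta> \<le> 1 - \<theta> / M k"
      by (simp add: algebra_simps)
    then have "\<theta> / (1 - \<theta> / M k) \<le> 1"
      using c1 by simp
    then have "\<epsilon> / R\<^sup>2 * (\<theta> / (1 - \<theta> / M k)) \<le> \<epsilon> / R\<^sup>2 * 1"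
      using pos by (intro mult_left_mono) auto
    moreover have "\<eta> * s\<^sup>2 = \<epsilon> / R\<^sup>2 * \<theta>"
      using pos by (simp add: \<eta>)
    moreover have "1 / ?h k = \<epsilon> * M k / R\<^sup>2"
      by (simp add: h)
    ultimately show "1 / ?h k + \<eta> * s\<^sup>2 / (1 - \<eta> * ?h k * s\<^sup>2) \<le> \<epsilon> * (M k + 1) / R\<^sup>2"
      unfolding c by (simp add: distrib_left add_divide_distrib)
  qed
  also have "\<dots> \<le> ennreal ((M k / (M k - 1)) powr ?q)
      * ennreal (exp (\<eta> * (\<epsilon> * (real N + m + 1) / 2)) * ((real N + m) / M k) powr ?q)"
  proof (intro mult_mono ih ennreal_leI)
    have "\<eta> * ?h k * L\<^sup>2 / (2 * (1 - \<eta> * ?h k * s\<^sup>2)) = L\<^sup>2 / s\<^sup>2 * \<theta> / (2 * (M k - \<theta>))"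
    proof -
      have 1: "\<eta> * ?h k = \<theta> / (M k * s\<^sup>2)"
        using pos M2 by (simp add: \<eta> h)
      have 2: "1 - \<theta> / M k = (M k - \<theta>) / M k"
        using M2 by (simp add: field_simps)
      show ?thesis
        unfolding c unfolding 1 2 using M2 pos \<theta> by simp
    qed
    then show "(1 - \<eta> * ?h k * s\<^sup>2) powr (- (real CARD('n) / 2))
            * exp (\<eta> * ?h k * L\<^sup>2 / (2 * (1 - \<eta> * ?h k * s\<^sup>2))) \<le> (M k / (M k - 1)) powr ?q"
      using step_factor_bound[of \<theta> "M k" "L\<^sup>2 / s\<^sup>2" "real CARD('n)"] \<theta> M2 unfolding c by simp
  qed auto
  also have "\<dots> = ennreal (exp (\<eta> * (\<epsilon> * (real N + m + 1) / 2)) * ((real N + m) / M (Suc k)) powr ?q)"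
  proof -
    have "(real N + m) / M (Suc k) = (M k / (M k - 1)) * ((real N + m) / M k)"
      using M2 by (simp add: M)
    then have "((real N + m) / M (Suc k)) powr ?q
        = (M k / (M k - 1)) powr ?q * ((real N + m) / M k) powr ?q"
      using M2 m2 by (simp add: powr_mult del: times_divide_eq_left times_divide_eq_right)
    then show ?thesis
      by (simp add: ennreal_mult[symmetric] mult.left_commute)
  qed
  finally show ?case
    unfolding v' .
qed

section \<open>Minimum value, size of the offset, and averaging\<close>

lemma min_value_eq:
  assumes "is_arg_min f (\<lambda>_. True) xs"
  shows "min_value f = f xs"
proof -
  have "is_arg_min f (\<lambda>_. True) (arg_min f (\<lambda>_. True))"
    unfolding arg_min_def using assms by (rule someI)
  with assms show ?thesis
    unfolding min_value_def is_arg_min_def by (meson antisym not_le)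
qed

lemma offset_bounds:
  "sqrt (2 * real N) \<le> real (offset N)" "real (offset N) \<le> sqrt (2 * real N) + 1"
proof -
  have "real (offset N) = of_int \<lceil>sqrt (2 * real N)\<rceil>"
    unfolding offset_def by (simp add: ceiling_mono)
  then show "sqrt (2 * real N) \<le> real (offset N)" "real (offset N) \<le> sqrt (2 * real N) + 1"
    by linarith+
qed

text \<open>An offset of at least 2 keeps \<open>1 - 1 / m\<close> positive and makes the
  logarithmic estimate, which asks for \<open>M \<ge> 2\<close>, available down to
  \<open>M = m\<close>.\<close>

lemma offset_ge_2:
  assumes "N \<ge> 2"
  shows "real (offset N) \<ge> 2"
proof -
  have "2 = sqrt (2 * 2)"
    by (simp del: real_sqrt_mult)
  also have "\<dots> \<le> sqrt (2 * real N)"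
    using assms by (intro real_sqrt_le_mono) auto
  also note offset_bounds(1)
  finally show ?thesis .
qed

text \<open>Jensen's inequality with uniform weights, followed by the subgradient inequality at each
  iterate tested at \<open>xs\<close>.\<close>

lemma averaged_output_gap:
  fixes x0 :: "'a::real_inner"
  assumes "convex_on UNIV f" and "\<And>x. g x \<in> subdifferential f x"
  shows "f (averaged_output x0 h N g e) - f xs \<le> regret x0 h g xs (Suc N) e / (real N + 1)"
proof -
  let ?x = "subgradient_iterate x0 h g e" and ?w = "1 / (real N + 1)"
  have "f (averaged_output x0 h N g e) = f (\<Sum>k=0..N. ?w *\<^sub>R ?x k)"
    by (simp add: averaged_output_def scaleR_sum_right)
  also have "\<dots> \<le> (\<Sum>k=0..N. ?w * f (?x k))"
    using assms(1) by (intro convex_on_sum[where C = UNIV]) (auto simp: field_simps)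
  also have "\<dots> \<le> (\<Sum>k=0..N. ?w * (f xs + g (?x k) \<bullet> (?x k - xs)))"
  proof (intro sum_mono mult_left_mono)
    fix k
    have "f xs \<ge> f (?x k) + g (?x k) \<bullet> (xs - ?x k)"
      using assms(2)[of "?x k"] by (simp add: subdifferential_def)
    then show "f (?x k) \<le> f xs + g (?x k) \<bullet> (?x k - xs)"
      by (simp add: inner_diff_right)
  qed auto
  also have "\<dots> = f xs + regret x0 h g xs (Suc N) e / (real N + 1)"
    unfolding sum_distrib_left[symmetric] sum.distrib regret_def
    by (simp add: atLeast0AtMost lessThan_Suc_atMost field_simps)
  finally show ?thesis by simp
qed

section \<open>Failure probability and asymptotics\<close>

text \<open>Failure forces the regret of all \<open>N + 1\<close> iterates up to
  \<open>(N + 1) * \<epsilon>\<close>, whereas the potential at time \<open>N\<close> contains only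
  the first \<open>N\<close> summands. The last one is charged to the quadratic part, and the
  Chernoff inequality is applied at the reduced level \<open>T\<close>.\<close>

lemma failure_probability_bound:
  fixes x0 :: "real^'n"
  assumes pos: "R > 0" "s > 0" "\<epsilon> > 0" and N: "N \<ge> 2"
    and f: "f \<in> problem_class x0 R L"
    and g: "g \<in> subgradient_selections f"
    and P: "P \<in> admissible_noise s"
  shows "emeasure P {e \<in> space P. f (averaged_output x0 (harmonic_step R \<epsilon> N) N g e) - min_value f \<ge> \<epsilon>}
    \<le> ennreal (exp (- exponent_bound CARD('n) R L s \<epsilon> N))"
proof -
  let ?h = "harmonic_step R \<epsilon> N" and ?q = "L\<^sup>2 / s\<^sup>2 + real CARD('n) / 2"
  define m where "m = real (offset N)"
  define \<theta> where "\<theta> = 1 - 1 / m"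
  define \<eta> where "\<eta> = \<theta> * \<epsilon> / (R\<^sup>2 * s\<^sup>2)"
  \<comment> \<open>The weight of \<open>potential_mgf_bound\<close> at \<open>k = N\<close>, where
    \<open>M N = m\<close>.\<close>
  define v where "v = \<epsilon> * (m + 1) / R\<^sup>2"
  define T where "T = (real N + 1) * \<epsilon> - L\<^sup>2 / (2 * v)"
  have m2: "m \<ge> 2"
    using offset_ge_2[OF N] by (simp add: m_def)
  have \<theta>: "0 < \<theta>" "\<theta> \<le> 1"
    using m2 by (auto simp: \<theta>_def)
  have \<eta>0: "\<eta> > 0"
    using \<theta> pos by (simp add: \<eta>_def)
  have v0: "v > 0"
    using m2 pos by (simp add: v_def)
  obtain xs where conv: "convex_on UNIV f" and xs: "is_arg_min f (\<lambda>_. True) xs" "norm (x0 - xs) \<le> R"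
    and L: "\<And>x u. u \<in> subdifferential f x \<Longrightarrow> norm u \<le> L"
    using f by (auto simp: problem_class_def)
  have gm: "g \<in> borel_measurable borel" and gs: "\<And>x. g x \<in> subdifferential f x"
    using g by (auto simp: subgradient_selections_def)
  have gL: "norm (g x) \<le> L" for x
    using L gs .
  have g0: "0 \<le> g x \<bullet> (x - xs)" for x
  proof -
    have "f xs \<ge> f x + g x \<bullet> (xs - x)"
      using gs[of x] by (simp add: subdifferential_def)
    moreover have "f xs \<le> f x"
      using xs(1) by (auto simp: is_arg_min_def not_less)
    ultimately show ?thesis
      by (simp add: inner_diff_right)
  qed
  let ?pot = "potential x0 ?h g xs v N"
  have "subalgebra P (noise_history N)"
    using P by (intro subalgebra_noise_history) (simp add: admissible_noise_def)
  then have pot_meas[measurable]: "?pot \<in> borel_measurable P"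
    using measurable_potential[OF gm] by (rule measurable_from_subalg)
  have pot: "T \<le> ?pot e"
    if "f (averaged_output x0 ?h N g e) - min_value f \<ge> \<epsilon>" for e
  proof -
    let ?x = "subgradient_iterate x0 ?h g e N"
    have "\<epsilon> \<le> regret x0 ?h g xs (Suc N) e / (real N + 1)"
      using that averaged_output_gap[OF conv gs, of x0 ?h N e xs]
      by (simp add: min_value_eq[OF xs(1)])
    then have "(real N + 1) * \<epsilon> \<le> regret x0 ?h g xs (Suc N) e"
      by (simp add: field_simps)
    also have "\<dots> = regret x0 ?h g xs N e + g ?x \<bullet> (?x - xs)"
      by (simp add: regret_def)
    also have "g ?x \<bullet> (?x - xs) \<le> L * norm (?x - xs)"
      by (rule order_trans[OF norm_cauchy_schwarz mult_right_mono[OF gL norm_ge_zero]])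
    \<comment> \<open>Young's inequality with weight \<open>v\<close>; its remainder is what
      \<open>T\<close> subtracts.\<close>
    also have "\<dots> \<le> v * (norm (?x - xs))\<^sup>2 / 2 + L\<^sup>2 / (2 * v)"
    proof -
      have "0 \<le> (v * norm (?x - xs) - L)\<^sup>2 / (2 * v)"
        using v0 by simp
      also have "\<dots> = v * (norm (?x - xs))\<^sup>2 / 2 + L\<^sup>2 / (2 * v) - L * norm (?x - xs)"
        using v0 by (simp add: field_simps power2_eq_square)
      finally show ?thesis by simp
    qed
    finally show ?thesis
      by (simp add: T_def potential_def)
  qed
  have "emeasure P {e \<in> space P. f (averaged_output x0 ?h N g e) - min_value f \<ge> \<epsilon>}
      \<le> emeasure P {e \<in> space P. ?pot e \<ge> T}"
    using pot by (intro emeasure_mono) auto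
  also have "\<dots> \<le> ennreal (exp (- \<eta> * T)) * (\<integral>\<^sup>+e. ennreal (exp (\<eta> * ?pot e)) * indicator (space P) e \<partial>P)"
    using \<eta>0 by (intro Chernoff_ineq_nn_integral_ge) auto
  also have "(\<integral>\<^sup>+e. ennreal (exp (\<eta> * ?pot e)) * indicator (space P) e \<partial>P)
      = (\<integral>\<^sup>+e. ennreal (exp (\<eta> * ?pot e)) \<partial>P)"
    by (intro nn_integral_cong) simp
  also have "\<dots> \<le> ennreal (exp (\<eta> * (\<epsilon> * (real N + m + 1) / 2)) * ((real N + m) / m) powr ?q)"
    using potential_mgf_bound[OF P gm gL g0 pos xs(2) offset_ge_2[OF N] order_refl]
    by (simp add: m_def \<theta>_def \<eta>_def v_def)
  also have "ennreal (exp (- \<eta> * T)) * ennreal (exp (\<eta> * (\<epsilon> * (real N + m + 1) / 2)) * ((real N + m) / m) powr ?q)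
      = ennreal (exp (- \<eta> * T + \<eta> * (\<epsilon> * (real N + m + 1) / 2) + ?q * ln ((real N + m) / m)))"
    unfolding exp_add using m2 by (simp add: ennreal_mult[symmetric] powr_def mult.assoc)
  also have "\<dots> \<le> ennreal (exp (- exponent_bound CARD('n) R L s \<epsilon> N))"
  proof (intro ennreal_leI, subst exp_le_cancel_iff)
    define c where "c = \<epsilon>\<^sup>2 / (2 * R\<^sup>2 * s\<^sup>2)"
    have c0: "c \<ge> 0"
      by (simp add: c_def)
    \<comment> \<open>The Young remainder is estimated like one further step with
      \<open>M = m\<close>. Its factor \<open>m / (m - 1)\<close> turns the denominator
      \<open>m\<close> of the telescoped ratio into \<open>m - 1\<close>.\<close>
    have "\<eta> * (L\<^sup>2 / (2 * v)) = L\<^sup>2 / s\<^sup>2 * (\<theta> / (2 * (m + 1)))"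
      using pos m2 by (simp add: \<eta>_def v_def)
    also have "\<dots> \<le> L\<^sup>2 / s\<^sup>2 * (1 / (2 * (m - 1)))"
      using \<theta> m2 by (intro mult_left_mono frac_le) auto
    also have "\<dots> \<le> L\<^sup>2 / s\<^sup>2 * ln (m / (m - 1))"
      by (intro mult_left_mono inverse_le_ln_ratio m2) auto
    also have "\<dots> \<le> ?q * ln (m / (m - 1))"
      using m2 by (intro mult_right_mono) auto
    finally have "\<eta> * (L\<^sup>2 / (2 * v)) + ?q * ln ((real N + m) / m)
        \<le> ?q * (ln (m / (m - 1)) + ln ((real N + m) / m))"
      unfolding distrib_left by (rule add_right_mono)
    also have "ln (m / (m - 1)) + ln ((real N + m) / m) = ln ((real N + m) / (m - 1))"
      using m2 by (simp add: ln_div)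
    finally have log: "\<eta> * (L\<^sup>2 / (2 * v)) + ?q * ln ((real N + m) / m) \<le> ?q * ln ((real N + m) / (m - 1))" .
    \<comment> \<open>The right side equals \<open>real N + 2 - m - (real N + 1) / m\<close>, so the
      slack is \<open>(real N + 1) / m\<close>.\<close>
    have "real N + 2 - m - 2 * (real N + 1) / m \<le> \<theta> * (real N + 1 - m)"
      using m2 by (simp add: \<theta>_def field_simps)
    then have "c * (real N + 2 - m - 2 * (real N + 1) / m) \<le> c * (\<theta> * (real N + 1 - m))"
      using c0 by (rule mult_left_mono)
    also have "\<dots> = \<eta> * \<epsilon> / 2 * (real N + 1 - m)"
      by (simp add: c_def \<eta>_def power2_eq_square ac_simps)
    also have "\<dots> = \<eta> * ((real N + 1) * \<epsilon>) - \<eta> * (\<epsilon> * (real N + m + 1) / 2)"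
      by (simp add: algebra_simps add_divide_distrib diff_divide_distrib)
    finally show "- \<eta> * T + \<eta> * (\<epsilon> * (real N + m + 1) / 2) + ?q * ln ((real N + m) / m)
        \<le> - exponent_bound CARD('n) R L s \<epsilon> N"
      using log unfolding exponent_bound_def Let_def m_def[symmetric] c_def[symmetric] T_def
        right_diff_distrib mult_minus_left
      by linarith
  qed
  finally show ?thesis
    by (simp add: mult_left_mono)
qed

section \<open>Passage to the failure exponent, and its leading order\<close>

lemma neg_log_ge:
  assumes "p \<le> ennreal (exp (- B))"
  shows "neg_log p \<ge> ereal B"
proof (cases "p = 0")
  case False
  \<comment> \<open>\<open>enn2real\<close> sends \<open>top\<close> to 0, so finiteness is needed
    to keep a nonzero \<open>p\<close> positive on the reals.\<close>
  have fin: "p < top"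
    using assms by (rule le_less_trans) simp
  have "enn2real p \<le> exp (- B)"
    using enn2real_mono[OF assms] by simp
  moreover have "enn2real p > 0"
    using False fin by (simp add: enn2real_positive_iff zero_less_iff_neq_zero)
  ultimately have "ln (enn2real p) \<le> - B"
    by (simp add: ln_le_cancel_iff[symmetric] del: ln_le_cancel_iff)
  then show ?thesis
    using False by (simp add: neg_log_def)
qed (simp add: neg_log_def)

text \<open>Dividing by the leading term leaves three relative errors: \<open>a\<close> from
  \<open>2 - m\<close>, \<open>b\<close> from \<open>2 * (N + 1) / m\<close>, and a multiple of
  \<open>l\<close> from the logarithm. The first two have order \<open>1 / sqrt N\<close>, the third
  \<open>ln N / N\<close>. Enclosing \<open>m\<close> between \<open>sqrt (2 * N)\<close> and
  \<open>sqrt (2 * N) + 1\<close> removes the ceiling, so that the limits concern explicit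
  functions.\<close>

lemma exponent_bound_asymptotics:
  fixes R L s \<epsilon> :: real
  assumes pos: "R > 0" "s > 0" "\<epsilon> > 0"
  shows "\<exists>\<delta> \<in> o(\<lambda>_. 1). \<forall>N\<ge>2.
           exponent_bound d R L s \<epsilon> N = \<epsilon>\<^sup>2 * real N / (2 * R\<^sup>2 * s\<^sup>2) * (1 - \<delta> N)"
proof -
  define c where "c = \<epsilon>\<^sup>2 / (2 * R\<^sup>2 * s\<^sup>2)"
  define K where "K = (L\<^sup>2 / s\<^sup>2 + real d / 2) / c"
  define m where "m N = real (offset N)" for N
  have c: "c > 0"
    using pos by (simp add: c_def)
  define a where "a N = (m N - 2) / real N" for N
  define b where "b N = 2 * (real N + 1) / (m N * real N)" for N
  define l where "l N = ln ((real N + m N) / (m N - 1)) / real N" for N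
  define \<delta> where "\<delta> N = a N + b N + K * l N" for N
  have m: "sqrt (2 * real N) \<le> m N" "m N \<le> sqrt (2 * real N) + 1" for N
    using offset_bounds by (auto simp: m_def)
  have m2: "m N \<ge> 2" if "N \<ge> 2" for N
    using offset_ge_2[OF that] by (simp add: m_def)
  have "exponent_bound d R L s \<epsilon> N = \<epsilon>\<^sup>2 * real N / (2 * R\<^sup>2 * s\<^sup>2) * (1 - \<delta> N)" if "N \<ge> 2" for N
  proof -
    have "\<epsilon>\<^sup>2 * real N / (2 * R\<^sup>2 * s\<^sup>2) * (1 - \<delta> N) = c * (real N * (1 - \<delta> N))"
      by (simp add: c_def)
    also have "real N * (1 - \<delta> N) = real N + 2 - m N - 2 * (real N + 1) / m N
        - K * ln ((real N + m N) / (m N - 1))"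
      using that m2[OF that] by (simp add: \<delta>_def a_def b_def l_def field_simps)
    also have "c * \<dots> = exponent_bound d R L s \<epsilon> N"
      using c unfolding exponent_bound_def Let_def m_def[symmetric] c_def[symmetric]
      by (simp add: K_def right_diff_distrib)
    finally show ?thesis by simp
  qed
  moreover have "\<delta> \<in> o(\<lambda>_. 1)"
  proof (rule smalloI_tendsto)
    have ev: "eventually (\<lambda>N. N \<ge> 2) sequentially"
      by (rule eventually_ge_at_top)
    have "a \<longlonglongrightarrow> 0"
    proof (rule tendsto_sandwich)
      show "eventually (\<lambda>N. 0 \<le> a N) sequentially"
        using ev by eventually_elim (use m2 in \<open>simp add: a_def\<close>)
      show "eventually (\<lambda>N. a N \<le> (sqrt (2 * real N) + 1) / real N) sequentially"
        using m(2) by (intro always_eventually allI) (auto simp: a_def intro!: divide_right_mono order_trans[OF _ m(2)])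
    qed (simp, real_asymp)
    moreover have "b \<longlonglongrightarrow> 0"
    proof (rule tendsto_sandwich)
      show "eventually (\<lambda>N. 0 \<le> b N) sequentially"
        by (intro always_eventually allI) (simp add: b_def m_def)
      show "eventually (\<lambda>N. b N \<le> 2 * (real N + 1) / (sqrt (2 * real N) * real N)) sequentially"
        using ev
      proof eventually_elim
        case (elim N)
        then show ?case
          unfolding b_def using m(1)[of N] by (intro divide_left_mono mult_right_mono mult_pos_pos)
            (auto intro: less_le_trans[OF _ m2[OF elim]])
      qed
    qed (simp, real_asymp)
    moreover have "l \<longlonglongrightarrow> 0"
    proof (rule tendsto_sandwich)
      show "eventually (\<lambda>N. 0 \<le> l N) sequentially"
        using ev by eventually_elim (use m2 in \<open>force simp: l_def\<close>)
      show "eventually (\<lambda>N. l N \<le> ln (real N + (sqrt (2 * real N) + 1)) / real N) sequentially"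
        using ev
      proof eventually_elim
        case (elim N)
        have "(real N + m N) / (m N - 1) \<le> (real N + m N) / 1"
          using m2[OF elim] by (intro divide_left_mono) auto
        also have "\<dots> \<le> real N + (sqrt (2 * real N) + 1)"
          using m(2)[of N] by simp
        finally show ?case
          unfolding l_def using m2[OF elim] by (intro divide_right_mono ln_mono) auto
      qed
    qed (simp, real_asymp)
    ultimately have "(\<lambda>N. a N + b N + K * l N) \<longlonglongrightarrow> 0 + 0 + K * 0"
      by (intro tendsto_intros)
    then show "(\<lambda>N. \<delta> N / 1) \<longlonglongrightarrow> 0"
      by (simp add: \<delta>_def)
  qed simp
  ultimately show ?thesis by blast
qed

theorem theorem1:
  fixes x0 :: "real^'n" and R L s \<epsilon> :: real
  assumes "R > 0" and "L > 0" and "s > 0" and "0 < \<epsilon>" and "\<epsilon> < R * L"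
  shows "(\<forall>N\<ge>2. failure_exponent x0 R L s \<epsilon> (averaged_output x0 (harmonic_step R \<epsilon> N) N)
              \<ge> ereal (exponent_bound CARD('n) R L s \<epsilon> N)) \<and>
         (\<exists>\<delta> \<in> o(\<lambda>_. 1). \<forall>N\<ge>2.
            exponent_bound CARD('n) R L s \<epsilon> N
              = \<epsilon>\<^sup>2 * real N / (2 * R\<^sup>2 * s\<^sup>2) * (1 - \<delta> N))"
proof (intro conjI allI impI exponent_bound_asymptotics)
  fix N :: nat
  assume "N \<ge> 2"
  with assms show "failure_exponent x0 R L s \<epsilon> (averaged_output x0 (harmonic_step R \<epsilon> N) N)
      \<ge> ereal (exponent_bound CARD('n) R L s \<epsilon> N)"
    \<comment> \<open>The probability bound is uniform in \<open>f\<close>, \<open>g\<close> and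
      \<open>P\<close>, so it passes to the three suprema.\<close>
    unfolding failure_exponent_def
    by (intro neg_log_ge SUP_least failure_probability_bound)
qed (use assms in auto)

end
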